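(* Let $A$ be an $n\times n$ nonnegative real matrix with spectral radius $\rho(A)$ all of whose row sums are nonzero, and let $M>0$, $N\ge0$, $k\ge0$ be integers. Consider the inequality \[ \min_{\substack{1\le i,j\le n\\ a_{ij}^{(M)}>0}} \left( \frac{r_i(A^{k+M})\, r_j(A^{k+N})}{r_i(A^k)\, r_j(A^k)} \right)^{\frac{1}{M+N}} \le \rho(A) \le \max_{\substack{1\le i,j\le n\\ a_{ij}^{(M)}>0}} \left( \frac{r_i(A^{k+M})\, r_j(A^{k+N})}{r_i(A^k)\, r_j(A^k)} \right)^{\frac{1}{M+N}}. \] If $A^{M+N}$ is irreducible, then equality holds on either side (and hence on both sides) of this inequality if and only if \[ \frac{r_i(A^{k+1})}{r_i(A^k)}=\rho(A)\quad\text{for all } i\in\{1,\ldots,n\}. \]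
   Context: $a_{ij}^{(m)}$ denotes the $(i,j)$ entry of $A^m$ (with $A^0=I$), and $r_i(B)=\sum_j b_{ij}$ is the $i$-th row sum of a matrix $B$. A nonnegative $n\times n$ matrix $B$ ($n\ge2$) is reducible if there is a permutation matrix $P$ with $PBP^T=\begin{pmatrix}X&Y\\0&Z\end{pmatrix}$, $X,Z$ square; otherwise irreducible. $\rho(A)$ is the maximum modulus of the eigenvalues of $A$. *)

theory Defs
  imports "Jordan_Normal_Form.Spectral_Radius"
begin

definition row_sum :: "real mat \<Rightarrow> nat \<Rightarrow> real" where
  "row_sum B i = (\<Sum>j<dim_col B. B $$ (i, j))"

definition permutation_mat :: "nat \<Rightarrow> real mat \<Rightarrow> bool" where
  "permutation_mat n P \<longleftrightarrow>
    (\<exists>\<pi>. \<pi> permutes {..<n} \<and> P = mat n n (\<lambda>(i, j). if j = \<pi> i then 1 else 0))"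

text \<open>Both diagonal blocks must be nonempty (without this every matrix would be reducible), so
  only matrices of size at least 2 can be reducible.\<close>

definition reducible_mat :: "real mat \<Rightarrow> bool" where
  "reducible_mat B \<longleftrightarrow>
    (\<exists>p q P X Y Z. 0 < p \<and> 0 < q \<and> B \<in> carrier_mat (p + q) (p + q) \<and>
       permutation_mat (p + q) P \<and>
       X \<in> carrier_mat p p \<and> Y \<in> carrier_mat p q \<and> Z \<in> carrier_mat q q \<and>
       P * B * transpose_mat P = four_block_mat X Y (0\<^sub>m q p) Z)"

abbreviation irreducible_mat :: "real mat \<Rightarrow> bool" where
  "irreducible_mat B \<equiv> \<not> reducible_mat B"

definition rho :: "real mat \<Rightarrow> real" where
  "rho A = spectral_radius (map_mat complex_of_real A)"

text \<open>Row and column indices run through \<open>0, \<dots>, n - 1\<close>.\<close>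

definition positive_pairs :: "real mat \<Rightarrow> (nat \<times> nat) set" where
  "positive_pairs B = {(i, j). i < dim_row B \<and> j < dim_col B \<and> B $$ (i, j) > 0}"

definition row_ratio :: "real mat \<Rightarrow> nat \<Rightarrow> nat \<Rightarrow> nat \<Rightarrow> nat \<times> nat \<Rightarrow> real" where
  "row_ratio A M N k = (\<lambda>(i, j).
     ((row_sum (A ^\<^sub>m (k + M)) i * row_sum (A ^\<^sub>m (k + N)) j) /
      (row_sum (A ^\<^sub>m k) i * row_sum (A ^\<^sub>m k) j)) powr (1 / real (M + N)))"

end

theory Submission
  imports Defs
begin

text \<open>
  Let \<open>x = A\<^sup>k e > 0\<close> with \<open>e\<close> the all-ones vector, let \<open>r(B) = B e\<close> be the vector of row
  sums, let \<open>p = M + N\<close>, and let \<open>\<mu>\<close> be a bound for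
  the quantities whose \<open>p\<close>-th roots occur in the inequality. Since
  \<open>A\<^sup>p x = A\<^sup>M r(A\<^bsup>k+N\<^esup>)\<close> and \<open>A\<^sup>M x = r(A\<^bsup>k+M\<^esup>)\<close>, these bounds on pairs with a positive
  entry of \<open>A\<^sup>M\<close> sum up to \<open>A\<^sup>p x \<le> \<mu> x\<close> (respectively \<open>\<ge>\<close>). In the case of equality
  \<open>\<mu> = \<rho>(A)\<^sup>p\<close>; if the vector inequality were not an equation, multiplying by a power of
  \<open>1 + A\<^sup>p\<close> would make it strict in every component, which contradicts the bounds for \<open>\<rho>(A)\<close>
  by positive test vectors. So \<open>x\<close> and \<open>A x\<close> are both eigenvectors of the irreducible matrix
  \<open>A\<^sup>p\<close> for the same eigenvalue, hence proportional.
\<close>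

section \<open>Nonnegative matrices, positive vectors and matrix powers\<close>

definition nonneg_matrix :: "nat \<Rightarrow> real mat \<Rightarrow> bool" where
  "nonneg_matrix n A \<longleftrightarrow> A \<in> carrier_mat n n \<and> (\<forall>i<n. \<forall>j<n. 0 \<le> A $$ (i, j))"

definition pos_vec :: "nat \<Rightarrow> real vec \<Rightarrow> bool" where
  "pos_vec n v \<longleftrightarrow> v \<in> carrier_vec n \<and> (\<forall>i<n. 0 < v $ i)"

lemma nonneg_matrixD:
  assumes "nonneg_matrix n A"
  shows "A \<in> carrier_mat n n" "dim_row A = n" "dim_col A = n"
    "\<And>i j. i < n \<Longrightarrow> j < n \<Longrightarrow> 0 \<le> A $$ (i, j)"
  using assms by (auto simp: nonneg_matrix_def)

lemma pos_vecD:
  assumes "pos_vec n v"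
  shows "v \<in> carrier_vec n" "dim_vec v = n" "\<And>i. i < n \<Longrightarrow> 0 < v $ i"
  using assms by (auto simp: pos_vec_def)

lemma mult_mat_vec_nth:
  assumes "A \<in> carrier_mat n n" "v \<in> carrier_vec n" "i < n"
  shows "(A *\<^sub>v v) $ i = (\<Sum>j<n. A $$ (i, j) * v $ j)"
  using assms by (auto simp: scalar_prod_def lessThan_atLeast0 intro!: sum.cong)

lemma index_mult_mat_sum:
  assumes "A \<in> carrier_mat n n" "B \<in> carrier_mat n n" "i < n" "j < n"
  shows "(A * B) $$ (i, j) = (\<Sum>l<n. A $$ (i, l) * B $$ (l, j))"
  using assms by (simp add: scalar_prod_def lessThan_atLeast0)

lemma pow_mat_add_mult_vec:
  fixes A :: "real mat"
  assumes A: "A \<in> carrier_mat n n" and v: "v \<in> carrier_vec n"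
  shows "A ^\<^sub>m (a + b) *\<^sub>v v = A ^\<^sub>m a *\<^sub>v (A ^\<^sub>m b *\<^sub>v v)"
  using v
proof (induction b arbitrary: v)
  case 0
  then show ?case using A by simp
next
  case (Suc b)
  have Av: "A *\<^sub>v v \<in> carrier_vec n" using A Suc.prems by auto
  have "A ^\<^sub>m (a + Suc b) *\<^sub>v v = A ^\<^sub>m (a + b) *\<^sub>v (A *\<^sub>v v)"
    using A Suc.prems by (simp add: assoc_mult_mat_vec[of _ n n _ n])
  also have "\<dots> = A ^\<^sub>m a *\<^sub>v (A ^\<^sub>m b *\<^sub>v (A *\<^sub>v v))" by (rule Suc.IH[OF Av])
  also have "A ^\<^sub>m b *\<^sub>v (A *\<^sub>v v) = A ^\<^sub>m Suc b *\<^sub>v v"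
    using A Suc.prems by (simp add: assoc_mult_mat_vec[of _ n n _ n])
  finally show ?case .
qed

lemma smult_pow_mat:
  fixes A :: "'a :: comm_ring_1 mat"
  assumes A: "A \<in> carrier_mat n n"
  shows "(c \<cdot>\<^sub>m A) ^\<^sub>m m = c ^ m \<cdot>\<^sub>m A ^\<^sub>m m"
proof (induction m)
  case 0
  then show ?case using A by auto
next
  case (Suc m)
  have P: "A ^\<^sub>m m \<in> carrier_mat n n" using A by simp
  have "(c \<cdot>\<^sub>m A) ^\<^sub>m Suc m = c ^ m \<cdot>\<^sub>m A ^\<^sub>m m * (c \<cdot>\<^sub>m A)" by (simp add: Suc.IH)
  also have "\<dots> = c ^ m \<cdot>\<^sub>m (c \<cdot>\<^sub>m (A ^\<^sub>m m * A))"
    using mult_smult_assoc_mat[OF P, of "c \<cdot>\<^sub>m A" n "c ^ m"] mult_smult_distrib[OF P A, of c] A by simp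
  also have "\<dots> = c ^ Suc m \<cdot>\<^sub>m A ^\<^sub>m Suc m"
    by (rule eq_matI) (simp_all add: algebra_simps)
  finally show ?case .
qed

lemma pow_mat_commute:
  fixes A :: "real mat"
  assumes A: "A \<in> carrier_mat n n" and B: "B \<in> carrier_mat n n" and AB: "A * B = B * A"
  shows "A ^\<^sub>m m * B = B * A ^\<^sub>m m"
proof (induction m)
  case 0
  then show ?case using A B by auto
next
  case (Suc m)
  have P: "A ^\<^sub>m m \<in> carrier_mat n n" using A by simp
  have "A ^\<^sub>m Suc m * B = A ^\<^sub>m m * (A * B)" using A B P by (simp add: assoc_mult_mat[of _ n n _ n _ n])
  also have "\<dots> = A ^\<^sub>m m * B * A" unfolding AB using A B P by (simp add: assoc_mult_mat[of _ n n _ n _ n])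
  also have "\<dots> = B * A ^\<^sub>m Suc m" unfolding Suc.IH using A B P
    by (simp add: assoc_mult_mat[of _ n n _ n _ n])
  finally show ?case .
qed

lemma nonneg_matrix_pow:
  assumes A: "nonneg_matrix n A"
  shows "nonneg_matrix n (A ^\<^sub>m m)"
proof (induction m)
  case 0
  then show ?case using A by (auto simp: nonneg_matrix_def)
next
  case (Suc m)
  note A' = nonneg_matrixD[OF A] and P = nonneg_matrixD[OF Suc.IH]
  have "0 \<le> (A ^\<^sub>m m * A) $$ (i, j)" if "i < n" "j < n" for i j
  proof -
    have "(A ^\<^sub>m m * A) $$ (i, j) = (\<Sum>l<n. (A ^\<^sub>m m) $$ (i, l) * A $$ (l, j))"
      by (rule index_mult_mat_sum[OF P(1) A'(1) that])
    also have "\<dots> \<ge> 0" using A'(4) P(4) that by (intro sum_nonneg mult_nonneg_nonneg) auto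
    finally show ?thesis .
  qed
  then show ?case using mult_carrier_mat[OF P(1) A'(1)] by (simp add: nonneg_matrix_def)
qed

lemma nonneg_matrix_mult_vec_mono:
  assumes A: "nonneg_matrix n A" and v: "v \<in> carrier_vec n" and w: "w \<in> carrier_vec n"
    and le: "\<And>j. j < n \<Longrightarrow> v $ j \<le> w $ j" and i: "i < n"
  shows "(A *\<^sub>v v) $ i \<le> (A *\<^sub>v w) $ i"
  unfolding mult_mat_vec_nth[OF nonneg_matrixD(1)[OF A] v i]
    mult_mat_vec_nth[OF nonneg_matrixD(1)[OF A] w i]
  using nonneg_matrixD[OF A] le i by (intro sum_mono mult_left_mono) auto

section \<open>Bounds for the spectral radius by positive test vectors\<close>

lemma rho_eigenvector:
  assumes A: "A \<in> carrier_mat n n" and n: "0 < n"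
  obtains y l where "eigenvector (map_mat complex_of_real A) y l" "norm l = rho A"
proof -
  have C: "map_mat complex_of_real A \<in> carrier_mat n n" using A by simp
  from spectral_radius_mem_max(1)[OF C n] obtain l
    where "eigenvalue (map_mat complex_of_real A) l" "norm l = rho A"
    by (auto simp: spectrum_def rho_def)
  then show ?thesis using that by (auto simp: eigenvalue_def)
qed

lemma rho_nonneg:
  assumes "A \<in> carrier_mat n n" and "0 < n"
  shows "0 \<le> rho A"
  using rho_eigenvector[OF assms] by (metis norm_ge_zero)

text \<open>Measure a complex eigenvector \<open>y\<close> for an eigenvalue of modulus
  \<open>rho A\<close> in the sup norm weighted by \<open>z\<close>. At an index where this norm is
  attained, the triangle inequality turns the strict inequality for \<open>z\<close> into one for
  \<open>rho A ^ p\<close>.\<close>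

lemma rho_pow_less:
  assumes A: "nonneg_matrix n A" and n: "0 < n" and z: "pos_vec n z"
    and lt: "\<And>i. i < n \<Longrightarrow> (A ^\<^sub>m p *\<^sub>v z) $ i < \<mu> * z $ i"
  shows "rho A ^ p < \<mu>"
proof -
  note A' = nonneg_matrixD[OF A] and z' = pos_vecD[OF z]
  note B = nonneg_matrixD[OF nonneg_matrix_pow[OF A, of p]]
  let ?C = "map_mat complex_of_real A"
  obtain y l where ev: "eigenvector ?C y l" and l: "norm l = rho A"
    using rho_eigenvector[OF A'(1) n] .
  have C: "?C \<in> carrier_mat n n" using A' by simp
  have y: "y \<in> carrier_vec n" "y \<noteq> 0\<^sub>v n" using ev A' by (auto simp: eigenvector_def)
  have pow: "?C ^\<^sub>m p *\<^sub>v y = l ^ p \<cdot>\<^sub>v y" by (rule eigenvector_pow[OF C ev])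
  have Cp: "?C ^\<^sub>m p = map_mat complex_of_real (A ^\<^sub>m p)"
    by (rule of_real_hom.mat_hom_pow[OF A'(1), symmetric])
  \<comment> \<open>The least constant with \<open>norm (y $ i) \<le> c * z $ i\<close> for all
    \<open>i\<close>. The index \<open>i\<close> obtained below attains it, and \<open>c\<close> is
    positive because \<open>y\<close> is nonzero.\<close>
  define c where "c = Max ((\<lambda>i. norm (y $ i) / z $ i) ` {..<n})"
  have c_ge: "norm (y $ i) \<le> c * z $ i" if "i < n" for i
  proof -
    have "norm (y $ i) / z $ i \<le> c" unfolding c_def using that by (intro Max_ge) auto
    then show ?thesis using z'(3)[OF that] by (simp add: field_simps)
  qed
  have "c \<in> (\<lambda>i. norm (y $ i) / z $ i) ` {..<n}" unfolding c_def using n by (intro Max_in) auto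
  then obtain i where i: "i < n" and ci: "norm (y $ i) = c * z $ i"
    using z'(3) by (force simp: field_simps)
  have c0: "0 < c"
  proof (rule ccontr)
    assume "\<not> 0 < c"
    have "y $ j = 0" if "j < n" for j
    proof -
      have "c * z $ j \<le> 0" using \<open>\<not> 0 < c\<close> z'(3)[OF that] by (simp add: mult_nonpos_nonneg)
      then show ?thesis using c_ge[OF that] by (smt (verit) norm_le_zero_iff)
    qed
    then have "y = 0\<^sub>v n" using y(1) by (intro eq_vecI) auto
    then show False using y(2) by simp
  qed
  \<comment> \<open>At the extremal index the left side is exact, while every term on the right is
    bounded through \<open>c_ge\<close>.\<close>
  have "rho A ^ p * (c * z $ i) = norm ((?C ^\<^sub>m p *\<^sub>v y) $ i)"
    unfolding pow using i y l ci by (simp add: norm_mult norm_power)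
  also have "(?C ^\<^sub>m p *\<^sub>v y) $ i = (\<Sum>j<n. complex_of_real ((A ^\<^sub>m p) $$ (i, j)) * y $ j)"
    unfolding Cp using B i y by (subst mult_mat_vec_nth[of _ n]) auto
  also have "norm \<dots> \<le> (\<Sum>j<n. (A ^\<^sub>m p) $$ (i, j) * (c * z $ j))"
    using B i c_ge by (intro sum_norm_le) (auto simp: norm_mult intro!: mult_left_mono)
  also have "\<dots> = c * (A ^\<^sub>m p *\<^sub>v z) $ i"
    unfolding mult_mat_vec_nth[OF B(1) z'(1) i] by (simp add: sum_distrib_left algebra_simps)
  also have "\<dots> < c * (\<mu> * z $ i)" using c0 lt[OF i] by simp
  finally have "rho A ^ p * (c * z $ i) < \<mu> * (c * z $ i)" by (simp add: algebra_simps)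
  then show ?thesis using c0 z'(3)[OF i] by simp
qed

text \<open>After scaling by \<open>1 / r\<close> the spectral radius is below 1, so the Jordan
  normal form bounds the entries of all powers uniformly. This supplies lower bounds for
  \<open>rho A\<close> without a Perron eigenvector.\<close>

lemma rho_pow_growth:
  assumes A: "A \<in> carrier_mat n n" and n: "0 < n" and r: "rho A < r"
  obtains c where "\<And>m i j. i < n \<Longrightarrow> j < n \<Longrightarrow> \<bar>(A ^\<^sub>m m) $$ (i, j)\<bar> \<le> c * r ^ m"
proof -
  have r0: "0 < r" using rho_nonneg[OF A n] r by simp
  let ?C = "map_mat complex_of_real A"
  define D where "D = complex_of_real (1 / r) \<cdot>\<^sub>m ?C"
  have C: "?C \<in> carrier_mat n n" using A by simp
  have D: "D \<in> carrier_mat n n" using A by (simp add: D_def)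
  have "spectral_radius D < 1"
  proof -
    from spectral_radius_mem_max(1)[OF D n] obtain l v
      where l: "norm l = spectral_radius D" and ev: "eigenvector D v l"
      by (auto simp: spectrum_def eigenvalue_def)
    have v: "v \<in> carrier_vec n" "v \<noteq> 0\<^sub>v n" and Dv: "D *\<^sub>v v = l \<cdot>\<^sub>v v"
      using ev D by (auto simp: eigenvector_def)
    \<comment> \<open>Undoing the scaling turns an eigenvalue \<open>l\<close> of \<open>D\<close>
      into the eigenvalue \<open>r * l\<close> of \<open>A\<close>, whose modulus is at most
      \<open>rho A < r\<close>.\<close>
    have "?C *\<^sub>v v = (complex_of_real r * l) \<cdot>\<^sub>v v"
    proof -
      have "D *\<^sub>v v = complex_of_real (1 / r) \<cdot>\<^sub>v (?C *\<^sub>v v)"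
        unfolding D_def using C v(1) by (intro eq_vecI) (auto simp: scalar_prod_def sum_distrib_left algebra_simps)
      then have "complex_of_real r \<cdot>\<^sub>v (l \<cdot>\<^sub>v v)
          = complex_of_real r \<cdot>\<^sub>v (complex_of_real (1 / r) \<cdot>\<^sub>v (?C *\<^sub>v v))"
        using Dv by simp
      then show ?thesis using r0 by (simp add: smult_smult_assoc)
    qed
    then have "eigenvalue ?C (complex_of_real r * l)"
      using v A by (auto simp: eigenvalue_def eigenvector_def)
    then have "norm (complex_of_real r * l) \<le> rho A"
      unfolding rho_def by (intro spectral_radius_mem_max(2)[OF C n]) (auto simp: spectrum_def)
    then have "r * spectral_radius D \<le> rho A" using r0 l by (simp add: norm_mult)
    then have "r * spectral_radius D < r * 1" using r by linarith
    then show ?thesis using r0 by (simp only: mult_less_cancel_left_pos)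
  qed
  from spectral_radius_jnf_norm_bound_less_1_upper_triangular[OF D this] obtain c
    where c: "\<And>m. norm_bound (D ^\<^sub>m m) c" by auto
  have "\<bar>(A ^\<^sub>m m) $$ (i, j)\<bar> \<le> c * r ^ m" if "i < n" "j < n" for m i j
  proof -
    have "D ^\<^sub>m m = complex_of_real (1 / r) ^ m \<cdot>\<^sub>m map_mat complex_of_real (A ^\<^sub>m m)"
      unfolding D_def smult_pow_mat[OF C] of_real_hom.mat_hom_pow[OF A] ..
    moreover have "norm ((D ^\<^sub>m m) $$ (i, j)) \<le> c"
      using c[of m] that D by (auto simp: norm_bound_def)
    ultimately have "\<bar>(A ^\<^sub>m m) $$ (i, j)\<bar> / r ^ m \<le> c"
      using that A r0 by (simp add: norm_mult norm_power norm_divide power_divide)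
    then show ?thesis using r0 by (simp add: field_simps)
  qed
  then show ?thesis using that by blast
qed

text \<open>Strictness in finitely many components leaves room for a factor
  \<open>\<nu> > \<mu>\<close>, and iteration makes the powers of \<open>A ^\<^sub>m p\<close> grow
  on \<open>z\<close> at least like \<open>\<nu> ^ m\<close>. If
  \<open>rho A ^ p \<le> \<mu>\<close>, the growth bound allows only a smaller rate.\<close>

lemma rho_pow_greater:
  assumes A: "nonneg_matrix n A" and n: "0 < n" and p: "0 < p" and z: "pos_vec n z"
    and gt: "\<And>i. i < n \<Longrightarrow> \<mu> * z $ i < (A ^\<^sub>m p *\<^sub>v z) $ i"
  shows "\<mu> < rho A ^ p"
proof (rule ccontr)
  assume "\<not> \<mu> < rho A ^ p"
  note A' = nonneg_matrixD[OF A] and z' = pos_vecD[OF z]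
  have rho0: "0 \<le> rho A" by (rule rho_nonneg[OF A'(1) n])
  define \<nu> where "\<nu> = Min ((\<lambda>i. (A ^\<^sub>m p *\<^sub>v z) $ i / z $ i) ` {..<n})"
  have \<nu>_le: "\<nu> * z $ i \<le> (A ^\<^sub>m p *\<^sub>v z) $ i" if "i < n" for i
  proof -
    have "\<nu> \<le> (A ^\<^sub>m p *\<^sub>v z) $ i / z $ i" unfolding \<nu>_def using that by (intro Min_le) auto
    then show ?thesis using z'(3)[OF that] by (simp add: field_simps)
  qed
  have "\<nu> \<in> (\<lambda>i. (A ^\<^sub>m p *\<^sub>v z) $ i / z $ i) ` {..<n}" unfolding \<nu>_def using n by (intro Min_in) auto
  then have \<nu>: "\<mu> < \<nu>" using gt z'(3) by (auto simp: field_simps)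
  \<comment> \<open>The midpoint gives \<open>rho A ^ p \<le> \<mu> < r ^ p < \<nu>\<close>:
    \<open>r\<close> exceeds \<open>rho A\<close>, yet \<open>r ^ p\<close> stays below the growth
    factor \<open>\<nu>\<close>. The negated claim makes \<open>\<mu>\<close> nonnegative, so the
    root is a genuine one.\<close>
  define r where "r = root p ((\<mu> + \<nu>) / 2)"
  have \<mu>0: "0 \<le> \<mu>" using \<open>\<not> \<mu> < rho A ^ p\<close> rho0 by (smt (verit) zero_le_power)
  have rp: "r ^ p = (\<mu> + \<nu>) / 2" unfolding r_def using p \<mu>0 \<nu> by (intro real_root_pow_pos2) auto
  have r0: "0 < r" unfolding r_def using p \<mu>0 \<nu> by simp
  have "rho A ^ p \<le> \<mu>" using \<open>\<not> \<mu> < rho A ^ p\<close> by (simp only: not_less)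
  also have "\<mu> < r ^ p" unfolding rp using \<nu> by simp
  finally have "rho A ^ p < r ^ p" .
  then have "rho A < r" using power_less_imp_less_base r0 less_imp_le by blast
  from rho_pow_growth[OF A'(1) n this] obtain c
    where c: "\<And>m i j. i < n \<Longrightarrow> j < n \<Longrightarrow> \<bar>(A ^\<^sub>m m) $$ (i, j)\<bar> \<le> c * r ^ m" by blast
  have growth: "\<nu> ^ m * z $ i \<le> (A ^\<^sub>m (p * m) *\<^sub>v z) $ i" if "i < n" for m i
    using that
  proof (induction m arbitrary: i)
    case 0
    then show ?case using z' A' by simp
  next
    case (Suc m)
    let ?w = "A ^\<^sub>m (p * m) *\<^sub>v z"
    have "\<nu> ^ Suc m * z $ i \<le> \<nu> ^ m * (A ^\<^sub>m p *\<^sub>v z) $ i"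
      using mult_left_mono[OF \<nu>_le[OF Suc.prems], of "\<nu> ^ m"] \<mu>0 \<nu> by (simp add: algebra_simps)
    also have "\<dots> = (A ^\<^sub>m p *\<^sub>v (\<nu> ^ m \<cdot>\<^sub>v z)) $ i"
      using mult_mat_vec[OF pow_carrier_mat[OF A'(1)] z'(1)] A'(2) Suc.prems by simp
    also have "\<dots> \<le> (A ^\<^sub>m p *\<^sub>v ?w) $ i"
    proof (rule nonneg_matrix_mult_vec_mono[OF nonneg_matrix_pow[OF A] _ _ _ Suc.prems])
      show "?w \<in> carrier_vec n"
        using mult_mat_vec_carrier[OF pow_carrier_mat[OF A'(1)] z'(1)] .
      show "(\<nu> ^ m \<cdot>\<^sub>v z) $ j \<le> ?w $ j" if "j < n" for j
        using Suc.IH[OF that] z'(2) that by simp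
    qed (use z'(1) in simp)
    also have "A ^\<^sub>m p *\<^sub>v ?w = A ^\<^sub>m (p * Suc m) *\<^sub>v z"
      using pow_mat_add_mult_vec[OF A'(1) z'(1), of p "p * m"] by simp
    finally show ?case .
  qed
  \<comment> \<open>Component 0 alone suffices for the contradiction: dividing its two bounds by
    \<open>r ^ (p * m)\<close> and \<open>z $ 0\<close> leaves \<open>t ^ m \<le> K\<close>, with
    \<open>t > 1\<close> and \<open>K\<close> independent of \<open>m\<close>.\<close>
  define K where "K = c * (\<Sum>j<n. z $ j) / z $ 0"
  define t where "t = \<nu> / r ^ p"
  have t: "1 < t" unfolding t_def rp using \<mu>0 \<nu> by (simp add: less_divide_eq)
  have "t ^ m \<le> K" for m
  proof -
    have "\<nu> ^ m * z $ 0 \<le> (\<Sum>j<n. (A ^\<^sub>m (p * m)) $$ (0, j) * z $ j)"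
      using growth[OF n, of m] unfolding mult_mat_vec_nth[OF pow_carrier_mat[OF A'(1)] z'(1) n] .
    also have "\<dots> \<le> (\<Sum>j<n. (c * r ^ (p * m)) * z $ j)"
    proof (intro sum_mono mult_right_mono)
      fix j assume "j \<in> {..<n}"
      then show "(A ^\<^sub>m (p * m)) $$ (0, j) \<le> c * r ^ (p * m)" "0 \<le> z $ j"
        using c[OF n, of j "p * m"] z'(3)[of j] by (auto simp: abs_le_iff)
    qed
    also have "\<dots> = c * (\<Sum>j<n. z $ j) * (r ^ p) ^ m"
      unfolding power_mult sum_distrib_left sum_distrib_right
      by (intro sum.cong refl) (simp only: mult_ac)
    also have "c * (\<Sum>j<n. z $ j) = K * z $ 0" using z'(3)[OF n] by (simp add: K_def)
    also have "K * z $ 0 * (r ^ p) ^ m = K * (r ^ p) ^ m * z $ 0" by (simp only: mult_ac)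
    finally have "\<nu> ^ m \<le> K * (r ^ p) ^ m" using z'(3)[OF n] by simp
    then show ?thesis using r0 by (simp add: t_def power_divide pos_divide_le_eq)
  qed
  moreover obtain m where "K < t ^ m" using real_arch_pow[OF t] by blast
  ultimately show False by (metis not_less)
qed

section \<open>Irreducible matrices\<close>

text \<open>The graph form of irreducibility. If all entries with row outside \<open>S\<close> and
  column in \<open>S\<close> vanished, listing the indices of \<open>S\<close> first would produce
  the zero lower left block.\<close>

lemma irreducible_mat_edge:
  assumes B: "B \<in> carrier_mat n n" and irr: "irreducible_mat B"
    and S: "S \<subseteq> {..<n}" "S \<noteq> {}" "S \<noteq> {..<n}"
  obtains i j where "i < n" "i \<notin> S" "j \<in> S" "B $$ (i, j) \<noteq> 0"
proof (rule ccontr)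
  assume "\<not> thesis"
  with that have zero: "B $$ (i, j) = 0" if "i < n" "i \<notin> S" "j \<in> S" for i j
    using \<open>i < n\<close> \<open>i \<notin> S\<close> \<open>j \<in> S\<close> by blast
  have finS: "finite S" using S(1) finite_subset by blast
  define p q where "p = card S" and "q = card ({..<n} - S)"
  have pq: "p + q = n" unfolding p_def q_def
    using S(1) finS by (metis card_Diff_subset card_lessThan card_mono finite_lessThan le_add_diff_inverse)
  have p0: "0 < p" unfolding p_def using S finS by (simp add: card_gt_0_iff)
  have q0: "0 < q" unfolding q_def using S by (auto simp: card_gt_0_iff)
  obtain f where f: "bij_betw f {..<p} S"
    using finite_same_card_bij[of "{..<p}" S] finS by (auto simp: p_def)
  have "card {p..<n} = card ({..<n} - S)" using pq by (simp add: q_def[symmetric])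
  then obtain g where g: "bij_betw g {p..<n} ({..<n} - S)"
    using finite_same_card_bij[of "{p..<n}" "{..<n} - S"] by blast
  \<comment> \<open>The first \<open>p\<close> positions enumerate \<open>S\<close>, the other
    \<open>q\<close> its complement; the identity beyond \<open>n\<close> is what
    \<open>permutes\<close> demands.\<close>
  define \<pi> where "\<pi> i = (if i < p then f i else if i < n then g i else i)" for i
  have f': "bij_betw \<pi> {..<p} S" using f by (rule bij_betw_cong[THEN iffD1, rotated]) (auto simp: \<pi>_def)
  have g': "bij_betw \<pi> {p..<n} ({..<n} - S)" using g
    by (rule bij_betw_cong[THEN iffD1, rotated]) (auto simp: \<pi>_def)
  have "bij_betw \<pi> ({..<p} \<union> {p..<n}) (S \<union> ({..<n} - S))"
    by (rule bij_betw_combine[OF f' g']) auto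
  moreover have "{..<p} \<union> {p..<n} = {..<n}" using pq by auto
  moreover have "S \<union> ({..<n} - S) = {..<n}" using S by auto
  ultimately have bij: "bij_betw \<pi> {..<n} {..<n}" by simp
  have perm: "\<pi> permutes {..<n}"
    by (rule bij_imp_permutes[OF bij]) (use pq in \<open>auto simp: \<pi>_def\<close>)
  have \<pi>n: "\<pi> i < n" if "i < n" for i using bij that by (auto simp: bij_betw_def)
  define P :: "real mat" where "P = mat n n (\<lambda>(i, j). if j = \<pi> i then 1 else 0)"
  have P: "P \<in> carrier_mat n n" by (simp add: P_def)
  let ?D = "P * B * transpose_mat P"
  have D: "?D \<in> carrier_mat n n" using P B by simp
  have PB: "(P * B) $$ (i, j) = B $$ (\<pi> i, j)" if "i < n" "j < n" for i j
    using that B \<pi>n by (auto simp: P_def scalar_prod_def if_distrib[of "\<lambda>x. x * _"] sum.delta cong: if_cong)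
  have entry: "?D $$ (i, j) = B $$ (\<pi> i, \<pi> j)" if "i < n" "j < n" for i j
  proof -
    have "?D $$ (i, j) = (\<Sum>l<n. (P * B) $$ (i, l) * transpose_mat P $$ (l, j))"
      using that P B by (intro index_mult_mat_sum) auto
    also have "\<dots> = (\<Sum>l<n. if l = \<pi> j then B $$ (\<pi> i, l) else 0)"
    proof (rule sum.cong)
      fix l assume "l \<in> {..<n}"
      then have "transpose_mat P $$ (l, j) = (if l = \<pi> j then 1 else 0)" "l < n"
        using that by (simp_all add: P_def)
      then show "(P * B) $$ (i, l) * transpose_mat P $$ (l, j) = (if l = \<pi> j then B $$ (\<pi> i, l) else 0)"
        unfolding PB[OF that(1) \<open>l < n\<close>] by simp
    qed simp
    also have "\<dots> = B $$ (\<pi> i, \<pi> j)" using \<pi>n[OF that(2)] by simp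
    finally show ?thesis .
  qed
  have zeroD: "?D $$ (i, j) = 0" if "p \<le> i" "i < n" "j < p" for i j
  proof -
    have "\<pi> i \<in> {..<n} - S" using g' that by (auto simp: bij_betw_def)
    moreover have "\<pi> j \<in> S" using f' that by (auto simp: bij_betw_def)
    ultimately show ?thesis using that pq entry zero by simp
  qed
  let ?X = "mat p p (\<lambda>ij. ?D $$ ij)"
  let ?Y = "mat p q (\<lambda>(i, j). ?D $$ (i, j + p))"
  let ?Z = "mat q q (\<lambda>(i, j). ?D $$ (i + p, j + p))"
  have "?D = four_block_mat ?X ?Y (0\<^sub>m q p) ?Z"
  proof (rule eq_matI)
    fix i j
    assume "i < dim_row (four_block_mat ?X ?Y (0\<^sub>m q p) ?Z)"
      and "j < dim_col (four_block_mat ?X ?Y (0\<^sub>m q p) ?Z)"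
    then have "i < n" "j < n" using pq by auto
    then show "?D $$ (i, j) = four_block_mat ?X ?Y (0\<^sub>m q p) ?Z $$ (i, j)"
      using pq zeroD[of i j] by (auto simp del: index_mult_mat)
  qed (use D pq in auto)
  moreover have "permutation_mat (p + q) P"
    unfolding permutation_mat_def pq using perm P_def by blast
  moreover have "B \<in> carrier_mat (p + q) (p + q)" using B pq by simp
  moreover have "?X \<in> carrier_mat p p" "?Y \<in> carrier_mat p q" "?Z \<in> carrier_mat q q" by auto
  ultimately have "reducible_mat B" unfolding reducible_mat_def using p0 q0 by blast
  with irr show False by simp
qed

section \<open>Powers of \<open>1 + B\<close> for irreducible \<open>B\<close>, and uniqueness of
  eigenvectors\<close>

lemma one_plus_mult_vec:
  fixes B :: "real mat"
  assumes B: "B \<in> carrier_mat n n" and v: "v \<in> carrier_vec n"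
  shows "(1\<^sub>m n + B) *\<^sub>v v = v + B *\<^sub>v v"
  using assms by (simp add: add_mult_distrib_mat_vec[of _ n n])

text \<open>The factor next to the vector is split off, since the inductions that use this
  generalise over the vector.\<close>

lemma one_plus_pow_Suc:
  fixes B :: "real mat"
  assumes B: "B \<in> carrier_mat n n" and v: "v \<in> carrier_vec n"
  shows "(1\<^sub>m n + B) ^\<^sub>m Suc m *\<^sub>v v = (1\<^sub>m n + B) ^\<^sub>m m *\<^sub>v (v + B *\<^sub>v v)"
proof -
  have C: "1\<^sub>m n + B \<in> carrier_mat n n" using B by simp
  show ?thesis
    using B v C pow_carrier_mat[OF C] by (simp add: assoc_mult_mat_vec[of _ n n _ n] one_plus_mult_vec)
qed

text \<open>Each application of \<open>1 + B\<close> enlarges the support of a nonnegative vector until it is full.\<close>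

lemma irreducible_mat_pow_pos:
  assumes B: "nonneg_matrix n B" and irr: "irreducible_mat B"
    and d: "d \<in> carrier_vec n" "\<And>i. i < n \<Longrightarrow> 0 \<le> d $ i" "\<exists>i<n. d $ i \<noteq> 0"
  shows "\<exists>m. pos_vec n ((1\<^sub>m n + B) ^\<^sub>m m *\<^sub>v d)"
  using d
proof (induction "card {i. i < n \<and> d $ i = 0}" arbitrary: d rule: less_induct)
  case less
  note B' = nonneg_matrixD[OF B]
  define S where "S = {i. i < n \<and> d $ i \<noteq> 0}"
  show ?case
  proof (cases "S = {..<n}")
    case True
    have "0 < d $ i" if "i < n" for i
    proof -
      have "i \<in> S" using True that by simp
      then show ?thesis using less.prems(2)[OF that] by (simp add: S_def)
    qed
    then have "pos_vec n d" using less.prems(1) by (simp add: pos_vec_def)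
    then have "pos_vec n ((1\<^sub>m n + B) ^\<^sub>m 0 *\<^sub>v d)" using B' less.prems by simp
    then show ?thesis by blast
  next
    case False
    have "S \<subseteq> {..<n}" "S \<noteq> {}" using less.prems by (auto simp: S_def)
    \<comment> \<open>Here \<open>d\<close> vanishes at \<open>i\<close> but not at
      \<open>j\<close>, so the term \<open>B $$ (i, j) * d $ j\<close> makes
      \<open>B *\<^sub>v d\<close> positive at \<open>i\<close>. As \<open>B *\<^sub>v d\<close> is
      nonnegative, no old support is lost and the number of zeros drops.\<close>
    from irreducible_mat_edge[OF B'(1) irr this False] obtain i j
      where ij: "i < n" "i \<notin> S" "j \<in> S" "B $$ (i, j) \<noteq> 0" .
    let ?e = "d + B *\<^sub>v d"
    have Bd: "(B *\<^sub>v d) $ l = (\<Sum>j<n. B $$ (l, j) * d $ j)" if "l < n" for l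
      by (rule mult_mat_vec_nth[OF B'(1) less.prems(1) that])
    have Bd0: "0 \<le> (B *\<^sub>v d) $ l" if "l < n" for l
      unfolding Bd[OF that] using B'(4) less.prems(2) that by (intro sum_nonneg mult_nonneg_nonneg) auto
    have e: "?e \<in> carrier_vec n" using B' less.prems by (simp add: mult_mat_vec_carrier[of _ n n])
    have el: "?e $ l = d $ l + (B *\<^sub>v d) $ l" if "l < n" for l using B' that by simp
    have e0: "0 \<le> ?e $ l" if "l < n" for l
      using el Bd0 less.prems(2) that by simp
    have "0 < (B *\<^sub>v d) $ i"
    proof -
      have "0 < B $$ (i, j) * d $ j" 
        using ij B'(4)[of i j] less.prems(2)[of j] by (auto simp: S_def)
      also have "\<dots> \<le> (B *\<^sub>v d) $ i" unfolding Bd[OF ij(1)]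
        using B'(4) less.prems(2) ij by (intro member_le_sum) (auto simp: S_def)
      finally show ?thesis .
    qed
    then have ei: "?e $ i \<noteq> 0" using el[OF ij(1)] less.prems(2)[OF ij(1)] by simp
    have "{l. l < n \<and> ?e $ l = 0} \<subset> {l. l < n \<and> d $ l = 0}"
    proof (rule psubsetI)
      show "{l. l < n \<and> ?e $ l = 0} \<subseteq> {l. l < n \<and> d $ l = 0}"
        using el Bd0 less.prems(2) by (auto simp del: index_add_vec) (smt (verit))
      show "{l. l < n \<and> ?e $ l = 0} \<noteq> {l. l < n \<and> d $ l = 0}"
        using ei ij by (auto simp: S_def simp del: index_add_vec)
    qed
    then have "card {l. l < n \<and> ?e $ l = 0} < card {l. l < n \<and> d $ l = 0}"
      by (intro psubset_card_mono) auto
    from less.hyps[OF this e e0] ei ij(1) obtain m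
      where "pos_vec n ((1\<^sub>m n + B) ^\<^sub>m m *\<^sub>v ?e)" by blast
    then have "pos_vec n ((1\<^sub>m n + B) ^\<^sub>m Suc m *\<^sub>v d)"
      unfolding one_plus_pow_Suc[OF B'(1) less.prems(1)] .
    then show ?thesis by blast
  qed
qed

lemma pos_vec_one_plus_pow:
  assumes B: "nonneg_matrix n B" and x: "pos_vec n x"
  shows "pos_vec n ((1\<^sub>m n + B) ^\<^sub>m m *\<^sub>v x)"
  using x
proof (induction m arbitrary: x)
  case 0
  then show ?case using nonneg_matrixD[OF B] pos_vecD[OF 0] by simp
next
  case (Suc m)
  note B' = nonneg_matrixD[OF B] and x' = pos_vecD[OF Suc.prems]
  have "0 \<le> (B *\<^sub>v x) $ i" if "i < n" for i
    unfolding mult_mat_vec_nth[OF B'(1) x'(1) that]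
    using B'(4) x'(3) that by (intro sum_nonneg mult_nonneg_nonneg) (auto intro: less_imp_le)
  then have "pos_vec n (x + B *\<^sub>v x)"
    using B' x' by (auto simp: pos_vec_def mult_mat_vec_carrier[of _ n n] add_pos_nonneg simp del: index_mult_mat_vec)
  then show ?case unfolding one_plus_pow_Suc[OF B'(1) x'(1)] by (rule Suc.IH)
qed

text \<open>The sign \<open>s\<close> covers sub- and superinvariant vectors at once.\<close>

lemma irreducible_mat_strict:
  assumes B: "nonneg_matrix n B" and irr: "irreducible_mat B" and x: "pos_vec n x"
    and ge: "\<And>i. i < n \<Longrightarrow> 0 \<le> s * ((B *\<^sub>v x) $ i - \<mu> * x $ i)"
    and ne: "\<exists>i<n. s * ((B *\<^sub>v x) $ i - \<mu> * x $ i) \<noteq> 0"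
  obtains z where "pos_vec n z" "\<And>i. i < n \<Longrightarrow> 0 < s * ((B *\<^sub>v z) $ i - \<mu> * z $ i)"
proof -
  note B' = nonneg_matrixD[OF B] and x' = pos_vecD[OF x]
  define d where "d = s \<cdot>\<^sub>v (B *\<^sub>v x - \<mu> \<cdot>\<^sub>v x)"
  have Bx: "B *\<^sub>v x \<in> carrier_vec n" using B'(1) x'(1) by simp
  have d: "d \<in> carrier_vec n" using Bx x' by (simp add: d_def)
  have dn: "d $ i = s * ((B *\<^sub>v x) $ i - \<mu> * x $ i)" if "i < n" for i
    using that B' x' by (simp add: d_def)
  obtain m where m: "pos_vec n ((1\<^sub>m n + B) ^\<^sub>m m *\<^sub>v d)"
    using irreducible_mat_pow_pos[OF B irr d] ge ne dn by metis
  define S where "S = (1\<^sub>m n + B) ^\<^sub>m m"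
  have C: "1\<^sub>m n + B \<in> carrier_mat n n" using B'(1) by simp
  have S: "S \<in> carrier_mat n n" using C by (simp add: S_def)
  \<comment> \<open>Since \<open>S\<close> commutes with \<open>B\<close>, applying \<open>S\<close>
    to the defect of \<open>x\<close> gives the defect of \<open>S *\<^sub>v x\<close>. The positive
    vector \<open>S *\<^sub>v d\<close> thus shows that \<open>S *\<^sub>v x\<close> is the desired
    \<open>z\<close>.\<close>
  have SB: "S * B = B * S" unfolding S_def
    by (rule pow_mat_commute[OF C B'(1)])
      (use B'(1) in \<open>simp add: add_mult_distrib_mat[of _ n n _ _ n] mult_add_distrib_mat[of _ n n _ n]\<close>)
  have Sx: "S *\<^sub>v x \<in> carrier_vec n" using S x' by simp
  have "S *\<^sub>v d = s \<cdot>\<^sub>v (S *\<^sub>v (B *\<^sub>v x) - \<mu> \<cdot>\<^sub>v (S *\<^sub>v x))"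
    unfolding d_def using S Bx x' by (simp add: mult_mat_vec[of _ n n] mult_minus_distrib_mat_vec[of _ n n])
  also have "S *\<^sub>v (B *\<^sub>v x) = B *\<^sub>v (S *\<^sub>v x)"
    using SB S B'(1) x'(1) by (metis assoc_mult_mat_vec)
  finally have Sd: "S *\<^sub>v d = s \<cdot>\<^sub>v (B *\<^sub>v (S *\<^sub>v x) - \<mu> \<cdot>\<^sub>v (S *\<^sub>v x))" .
  show ?thesis
  proof (rule that)
    show "pos_vec n (S *\<^sub>v x)" unfolding S_def by (rule pos_vec_one_plus_pow[OF B x])
    fix i assume i: "i < n"
    have "0 < (S *\<^sub>v d) $ i" using m i by (simp add: S_def pos_vec_def)
    then show "0 < s * ((B *\<^sub>v (S *\<^sub>v x)) $ i - \<mu> * (S *\<^sub>v x) $ i)"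
      unfolding Sd using i B' S x' by simp
  qed
qed

text \<open>Subtract from \<open>y\<close> the largest multiple of \<open>x\<close> that leaves a
  nonnegative vector \<open>w\<close>; it has a zero entry. Were \<open>w\<close> nonzero, some
  power of \<open>1 + B\<close> would make it positive everywhere, yet that power merely rescales
  the eigenvector \<open>w\<close>.\<close>

lemma irreducible_mat_eigenvector_unique:
  assumes B: "nonneg_matrix n B" and n: "0 < n" and irr: "irreducible_mat B" and x: "pos_vec n x"
    and Bx: "B *\<^sub>v x = \<mu> \<cdot>\<^sub>v x" and y: "y \<in> carrier_vec n" and By: "B *\<^sub>v y = \<mu> \<cdot>\<^sub>v y"
  obtains t where "y = t \<cdot>\<^sub>v x"
proof -
  note B' = nonneg_matrixD[OF B] and x' = pos_vecD[OF x]
  define t where "t = Min ((\<lambda>i. y $ i / x $ i) ` {..<n})"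
  define w where "w = y - t \<cdot>\<^sub>v x"
  have w: "w \<in> carrier_vec n" using x' y by (simp add: w_def)
  have wn: "w $ i = y $ i - t * x $ i" if "i < n" for i using that x' y by (simp add: w_def)
  have w0: "0 \<le> w $ i" if "i < n" for i
  proof -
    have "t \<le> y $ i / x $ i" unfolding t_def using that by (intro Min_le) auto
    then show ?thesis using x'(3)[OF that] wn[OF that] by (simp add: field_simps)
  qed
  have "t \<in> (\<lambda>i. y $ i / x $ i) ` {..<n}" unfolding t_def using n by (intro Min_in) auto
  then obtain i where i: "i < n" and ti: "t = y $ i / x $ i" by auto
  have wi: "w $ i = 0" using wn[OF i] ti x'(3)[OF i] by simp
  have "w = 0\<^sub>v n"
  proof (rule ccontr)
    assume ne: "w \<noteq> 0\<^sub>v n"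
    then have "\<exists>i<n. w $ i \<noteq> 0" using w by (metis carrier_vecD eq_vecI index_zero_vec)
    from irreducible_mat_pow_pos[OF B irr w w0 this] obtain m
      where m: "pos_vec n ((1\<^sub>m n + B) ^\<^sub>m m *\<^sub>v w)" by blast
    have C: "1\<^sub>m n + B \<in> carrier_mat n n" using B'(1) by simp
    have "B *\<^sub>v w = \<mu> \<cdot>\<^sub>v w"
      unfolding w_def using B'(1) x'(1,2) y Bx By
      by (subst mult_minus_distrib_mat_vec[of _ n n])
        (auto simp: mult_mat_vec[of _ n n] algebra_simps intro!: eq_vecI)
    then have "(1\<^sub>m n + B) *\<^sub>v w = (1 + \<mu>) \<cdot>\<^sub>v w"
      unfolding one_plus_mult_vec[OF B'(1) w] using w by (auto intro!: eq_vecI simp: algebra_simps)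
    then have "eigenvector (1\<^sub>m n + B) w (1 + \<mu>)" using w ne B'(1,2) by (simp add: eigenvector_def)
    from eigenvector_pow[OF C this] m have "pos_vec n ((1 + \<mu>) ^ m \<cdot>\<^sub>v w)" by simp
    from pos_vecD(3)[OF this i] show False using wi w i by simp
  qed
  then have "y = t \<cdot>\<^sub>v x" using wn x' y by (auto intro!: eq_vecI)
  then show ?thesis using that by blast
qed

text \<open>The equality case for a single test vector: a one-sided bound with the exact constant
  \<open>rho A ^ p\<close> already forces a positive \<open>x\<close> to be an eigenvector of
  \<open>A\<close> itself.\<close>

lemma irreducible_pow_invariant:
  assumes A: "nonneg_matrix n A" and n: "0 < n" and p: "0 < p"
    and irr: "irreducible_mat (A ^\<^sub>m p)" and x: "pos_vec n x"
    and le_or_ge: "(\<forall>i<n. (A ^\<^sub>m p *\<^sub>v x) $ i \<le> rho A ^ p * x $ i) \<or>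
      (\<forall>i<n. rho A ^ p * x $ i \<le> (A ^\<^sub>m p *\<^sub>v x) $ i)"
  shows "A *\<^sub>v x = rho A \<cdot>\<^sub>v x"
proof -
  note A' = nonneg_matrixD[OF A] and x' = pos_vecD[OF x]
  note B = nonneg_matrix_pow[OF A, of p]
  note B' = nonneg_matrixD[OF B]
  let ?\<mu> = "rho A ^ p"
  have eq: "(A ^\<^sub>m p *\<^sub>v x) $ i = ?\<mu> * x $ i" if "i < n" for i
    using le_or_ge
  proof
    assume le: "\<forall>i<n. (A ^\<^sub>m p *\<^sub>v x) $ i \<le> ?\<mu> * x $ i"
    show ?thesis
    proof (rule ccontr)
      assume "(A ^\<^sub>m p *\<^sub>v x) $ i \<noteq> ?\<mu> * x $ i"
      \<comment> \<open>The sign -1 makes the defect of a subinvariant vector nonnegative; a strict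
        \<open>z\<close> would then yield \<open>rho A ^ p < rho A ^ p\<close>.\<close>
      with le that irreducible_mat_strict[OF B irr x, of "-1" ?\<mu>] obtain z where
        z: "pos_vec n z" "\<And>i. i < n \<Longrightarrow> 0 < - 1 * ((A ^\<^sub>m p *\<^sub>v z) $ i - ?\<mu> * z $ i)"
        by (metis diff_le_0_iff_le mult_minus1 neg_0_le_iff_le neg_equal_0_iff_equal right_minus_eq)
      have "?\<mu> < ?\<mu>" by (rule rho_pow_less[OF A n z(1)]) (use z(2) in force)
      then show False by simp
    qed
  next
    assume ge: "\<forall>i<n. ?\<mu> * x $ i \<le> (A ^\<^sub>m p *\<^sub>v x) $ i"
    show ?thesis
    proof (rule ccontr)
      assume "(A ^\<^sub>m p *\<^sub>v x) $ i \<noteq> ?\<mu> * x $ i"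
      with ge that irreducible_mat_strict[OF B irr x, of 1 ?\<mu>] obtain z where
        z: "pos_vec n z" "\<And>i. i < n \<Longrightarrow> 0 < 1 * ((A ^\<^sub>m p *\<^sub>v z) $ i - ?\<mu> * z $ i)"
        by (metis diff_ge_0_iff_ge mult_1 right_minus_eq)
      have "?\<mu> < ?\<mu>" by (rule rho_pow_greater[OF A n p z(1)]) (use z(2) in force)
      then show False by simp
    qed
  qed
  have Bx: "A ^\<^sub>m p *\<^sub>v x = ?\<mu> \<cdot>\<^sub>v x"
    using eq B' x' by (auto intro!: eq_vecI simp del: index_mult_mat_vec)
  have Ax: "A *\<^sub>v x \<in> carrier_vec n" using A'(1) x'(1) by simp
  \<comment> \<open>Since \<open>A\<close> commutes with its power, \<open>A *\<^sub>v x\<close>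
    satisfies the same eigenvector equation as \<open>x\<close>, and uniqueness makes it a multiple
    of \<open>x\<close>.\<close>
  have "A ^\<^sub>m p *\<^sub>v (A *\<^sub>v x) = A *\<^sub>v (A ^\<^sub>m p *\<^sub>v x)"
    using pow_mat_commute[OF A'(1) A'(1) refl, of p] A'(1) B'(1) x'(1) by (metis assoc_mult_mat_vec)
  also have "\<dots> = ?\<mu> \<cdot>\<^sub>v (A *\<^sub>v x)" unfolding Bx by (rule mult_mat_vec[OF A'(1) x'(1)])
  finally obtain t where t: "A *\<^sub>v x = t \<cdot>\<^sub>v x"
    using irreducible_mat_eigenvector_unique[OF B n irr x Bx Ax] by blast
  \<comment> \<open>The test vector bounds with exponent 1, applied to \<open>x\<close>, identify
    the factor \<open>t\<close> as \<open>rho A\<close>.\<close>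
  have A1: "A ^\<^sub>m 1 *\<^sub>v x = t \<cdot>\<^sub>v x" using A'(1) t by simp
  have "\<not> rho A < t"
  proof
    assume "rho A < t"
    then have "rho A < rho A ^ 1"
      by (intro rho_pow_greater[OF A n _ x]) (use x' A1 in auto)
    then show False by simp
  qed
  moreover have "\<not> t < rho A"
  proof
    assume "t < rho A"
    then have "rho A ^ 1 < rho A"
      by (intro rho_pow_less[OF A n x]) (use x' A1 in auto)
    then show False by simp
  qed
  ultimately show ?thesis using t by simp
qed

section \<open>Row sums of powers\<close>

lemma row_sum_eq:
  assumes "A \<in> carrier_mat n n" "i < n"
  shows "row_sum A i = (A *\<^sub>v vec n (\<lambda>_. 1)) $ i"
  using assms by (subst mult_mat_vec_nth[of _ n]) (auto simp: row_sum_def)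

text \<open>A nonzero row sum gives each row of the nonnegative \<open>A\<close> a positive entry,
  so \<open>A\<close> preserves positive vectors; in particular all denominators of the quotients
  are positive.\<close>

lemma pos_vec_pow_row_sum:
  assumes A: "nonneg_matrix n A" and rs: "\<And>i. i < n \<Longrightarrow> row_sum A i \<noteq> 0"
  shows "pos_vec n (A ^\<^sub>m m *\<^sub>v vec n (\<lambda>_. 1))"
proof -
  note A' = nonneg_matrixD[OF A]
  have step: "pos_vec n (A *\<^sub>v v)" if v: "pos_vec n v" for v
  proof -
    note v' = pos_vecD[OF v]
    have "0 < (A *\<^sub>v v) $ i" if i: "i < n" for i
    proof -
      have "\<exists>j<n. A $$ (i, j) \<noteq> 0"
        using rs[OF i] A'(3) by (metis lessThan_iff row_sum_def sum.neutral)
      then obtain j where j: "j < n" "A $$ (i, j) \<noteq> 0" by blast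
      have "0 < A $$ (i, j) * v $ j" using j A'(4)[OF i j(1)] v'(3) by simp
      also have "\<dots> \<le> (A *\<^sub>v v) $ i" unfolding mult_mat_vec_nth[OF A'(1) v'(1) i]
        using A'(4) v'(3) i j by (intro member_le_sum mult_nonneg_nonneg) (auto intro: less_imp_le)
      finally show ?thesis .
    qed
    then show ?thesis using A'(1) v'(1) by (simp add: pos_vec_def del: index_mult_mat_vec)
  qed
  show ?thesis
  proof (induction m)
    case 0
    then show ?case using A' by (simp add: pos_vec_def)
  next
    case (Suc m)
    have "A ^\<^sub>m (1 + m) *\<^sub>v vec n (\<lambda>_. 1) = A *\<^sub>v (A ^\<^sub>m m *\<^sub>v vec n (\<lambda>_. 1))"
      using A'(1) by (subst pow_mat_add_mult_vec[of _ n]) auto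
    then show ?case using step[OF Suc.IH] by simp
  qed
qed

text \<open>Lets the bounds on the roots be traded for bounds on the quotients themselves, against
  \<open>rho A ^ (M + N)\<close>.\<close>

lemma le_powr_inverse_iff:
  fixes a c :: real
  assumes "0 \<le> a" "0 < c" "0 < p"
  shows "a \<le> c powr (1 / real p) \<longleftrightarrow> a ^ p \<le> c"
    and "c powr (1 / real p) \<le> a \<longleftrightarrow> c \<le> a ^ p"
proof -
  have "(c powr (1 / real p)) ^ p = c"
    using assms by (simp add: powr_realpow[symmetric] powr_powr)
  then show "a \<le> c powr (1 / real p) \<longleftrightarrow> a ^ p \<le> c" "c powr (1 / real p) \<le> a \<longleftrightarrow> c \<le> a ^ p"
    using assms power_mono_iff[of a "c powr (1 / real p)" p] power_mono_iff[of "c powr (1 / real p)" a p]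
    by auto
qed

section \<open>Equality in the two-sided bound for the spectral radius\<close>

theorem theorem9:
  fixes A :: "real mat" and n M N k :: nat
  assumes "n \<ge> 1"
    and "A \<in> carrier_mat n n"
    and "\<And>i j. i < n \<Longrightarrow> j < n \<Longrightarrow> A $$ (i, j) \<ge> 0"
    and "\<And>i. i < n \<Longrightarrow> row_sum A i \<noteq> 0"
    and "M > 0"
    and "irreducible_mat (A ^\<^sub>m (M + N))"
  shows "(Min (row_ratio A M N k ` positive_pairs (A ^\<^sub>m M)) = rho A \<longleftrightarrow>
            (\<forall>i<n. row_sum (A ^\<^sub>m (k + 1)) i / row_sum (A ^\<^sub>m k) i = rho A))
       \<and> (rho A = Max (row_ratio A M N k ` positive_pairs (A ^\<^sub>m M)) \<longleftrightarrow>
            (\<forall>i<n. row_sum (A ^\<^sub>m (k + 1)) i / row_sum (A ^\<^sub>m k) i = rho A))"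
proof -
  have n: "0 < n" and p: "0 < M + N" using assms by auto
  have A: "nonneg_matrix n A" using assms by (simp add: nonneg_matrix_def)
  note A' = nonneg_matrixD[OF A]
  note AM = nonneg_matrixD[OF nonneg_matrix_pow[OF A, of M]]
  have rho0: "0 \<le> rho A" by (rule rho_nonneg[OF A'(1) n])
  define R where "R m = A ^\<^sub>m m *\<^sub>v vec n (\<lambda>_. 1)" for m
  define x where "x = R k"
  let ?p = "M + N"
  let ?P = "positive_pairs (A ^\<^sub>m M)"
  have R: "pos_vec n (R m)" for m
    unfolding R_def by (rule pos_vec_pow_row_sum[OF A assms(4)])
  note R' = pos_vecD[OF R]
  have Radd: "R (a + b) = A ^\<^sub>m a *\<^sub>v R b" for a b
    unfolding R_def by (rule pow_mat_add_mult_vec[OF A'(1)]) simp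
  have rs: "row_sum (A ^\<^sub>m m) i = R m $ i" if "i < n" for m i
    unfolding R_def using that A' by (intro row_sum_eq) auto
  have P: "?P = {(i, j). i < n \<and> j < n \<and> 0 < (A ^\<^sub>m M) $$ (i, j)}"
    using AM by (simp add: positive_pairs_def)
  have finP: "finite ?P" unfolding P by (rule finite_subset[of _ "{..<n} \<times> {..<n}"]) auto
  \<comment> \<open>\<open>Min\<close> and \<open>Max\<close> are meaningful only on a nonempty
    finite set; a positive row sum of \<open>A ^\<^sub>m M\<close> provides a pair.\<close>
  have neP: "?P \<noteq> {}"
  proof -
    have "0 < (\<Sum>j<n. (A ^\<^sub>m M) $$ (0, j))"
      using R'(3)[OF n, of M] rs[OF n, of M] AM by (simp add: row_sum_def)
    then obtain j where "j < n" "0 < (A ^\<^sub>m M) $$ (0, j)"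
      by (metis lessThan_iff not_less sum_nonpos)
    then show ?thesis using n unfolding P by blast
  qed
  define g where "g = (\<lambda>(i, j). (R (k + M) $ i * R (k + N) $ j) / (x $ i * x $ j))"
  have ratio: "row_ratio A M N k ij = g ij powr (1 / real ?p)" and gpos: "0 < g ij" if "ij \<in> ?P" for ij
    using that R'(3) unfolding P by (auto simp: row_ratio_def g_def rs x_def)
  have ApN: "A ^\<^sub>m ?p *\<^sub>v x = A ^\<^sub>m M *\<^sub>v R (k + N)"
    using Radd[of ?p k] Radd[of M "k + N"] by (simp add: x_def algebra_simps)
  have AMx: "A ^\<^sub>m M *\<^sub>v x = R (k + M)" using Radd[of M k] by (simp add: x_def add.commute)
  \<comment> \<open>The row sum condition is the eigenvector equation for \<open>x\<close>, read
    componentwise.\<close>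
  have ev_iff: "(\<forall>i<n. row_sum (A ^\<^sub>m (k + 1)) i / row_sum (A ^\<^sub>m k) i = rho A) \<longleftrightarrow>
      A *\<^sub>v x = rho A \<cdot>\<^sub>v x" (is "?E \<longleftrightarrow> _")
  proof -
    have Ax: "A *\<^sub>v x = R (k + 1)" using Radd[of 1 k] A'(1) by (simp add: x_def)
    have "A *\<^sub>v x = rho A \<cdot>\<^sub>v x \<longleftrightarrow> (\<forall>i<n. R (k + 1) $ i = rho A * x $ i)"
      unfolding Ax using R'(2)[of k] R'(2)[of "k + 1"] by (simp add: vec_eq_iff x_def)
    moreover have "R (k + 1) $ i = rho A * x $ i \<longleftrightarrow>
        row_sum (A ^\<^sub>m (k + 1)) i / row_sum (A ^\<^sub>m k) i = rho A" if "i < n" for i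
      using R'(3)[OF that, of k] unfolding rs[OF that] by (simp add: x_def divide_eq_eq)
    ultimately show ?thesis by blast
  qed
  let ?\<mu> = "rho A ^ ?p"
  \<comment> \<open>The factor \<open>R (k + M) $ i\<close>, which is the \<open>i\<close>-th entry
    of \<open>A ^\<^sub>m M *\<^sub>v x\<close>, completes each term to one containing
    \<open>g (i, j)\<close>. The companion \<open>AMx'\<close> is the same sum with
    \<open>?\<mu>\<close> in place of \<open>g (i, j)\<close>, so the two compare termwise.\<close>
  have AMy: "(A ^\<^sub>m ?p *\<^sub>v x) $ i * R (k + M) $ i =
      (\<Sum>j<n. (A ^\<^sub>m M) $$ (i, j) * g (i, j) * x $ j) * x $ i" if i: "i < n" for i
    unfolding ApN mult_mat_vec_nth[OF AM(1) R'(1) i] sum_distrib_right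
  proof (rule sum.cong[OF refl])
    fix j assume "j \<in> {..<n}"
    then have "x $ i \<noteq> 0" "x $ j \<noteq> 0" using R'(3)[OF i, of k] R'(3)[of j k] by (auto simp: x_def)
    then show "(A ^\<^sub>m M) $$ (i, j) * R (k + N) $ j * R (k + M) $ i =
        (A ^\<^sub>m M) $$ (i, j) * g (i, j) * x $ j * x $ i"
      by (simp add: g_def)
  qed
  have AMx': "?\<mu> * x $ i * R (k + M) $ i = (\<Sum>j<n. (A ^\<^sub>m M) $$ (i, j) * ?\<mu> * x $ j) * x $ i"
    if i: "i < n" for i
    unfolding AMx[symmetric] mult_mat_vec_nth[OF AM(1) R'(1)[of k, folded x_def] i]
    by (simp add: sum_distrib_right sum_distrib_left algebra_simps)
  have x: "pos_vec n x" using R by (simp add: x_def)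
  note x' = pos_vecD[OF x]
  \<comment> \<open>Pairs outside \<open>?P\<close> contribute nothing to either sum, so bounds for
    \<open>g\<close> on \<open>?P\<close> suffice.\<close>
  have zero: "(A ^\<^sub>m M) $$ (i, j) = 0" if "(i, j) \<notin> ?P" "i < n" "j < n" for i j
    using that AM(4)[of i j] unfolding P by auto
  have upper: "A *\<^sub>v x = rho A \<cdot>\<^sub>v x" if le: "\<And>ij. ij \<in> ?P \<Longrightarrow> g ij \<le> ?\<mu>"
  proof (rule irreducible_pow_invariant[OF A n p assms(6) x], intro disjI1 allI impI)
    fix i assume i: "i < n"
    have "(A ^\<^sub>m ?p *\<^sub>v x) $ i * R (k + M) $ i \<le> ?\<mu> * x $ i * R (k + M) $ i"
      unfolding AMy[OF i] AMx'[OF i]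
    proof (intro mult_right_mono sum_mono)
      fix j assume "j \<in> {..<n}"
      then show "(A ^\<^sub>m M) $$ (i, j) * g (i, j) \<le> (A ^\<^sub>m M) $$ (i, j) * ?\<mu>"
        using le[of "(i, j)"] zero[of i j] AM(4)[of i j] i by (cases "(i, j) \<in> ?P") (auto intro: mult_left_mono)
    qed (use x' i in \<open>auto intro: less_imp_le\<close>)
    then show "(A ^\<^sub>m ?p *\<^sub>v x) $ i \<le> ?\<mu> * x $ i" using R'(3)[OF i] by simp
  qed
  have lower: "A *\<^sub>v x = rho A \<cdot>\<^sub>v x" if ge: "\<And>ij. ij \<in> ?P \<Longrightarrow> ?\<mu> \<le> g ij"
  proof (rule irreducible_pow_invariant[OF A n p assms(6) x], intro disjI2 allI impI)
    fix i assume i: "i < n"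
    have "?\<mu> * x $ i * R (k + M) $ i \<le> (A ^\<^sub>m ?p *\<^sub>v x) $ i * R (k + M) $ i"
      unfolding AMy[OF i] AMx'[OF i]
    proof (intro mult_right_mono sum_mono)
      fix j assume "j \<in> {..<n}"
      then show "(A ^\<^sub>m M) $$ (i, j) * ?\<mu> \<le> (A ^\<^sub>m M) $$ (i, j) * g (i, j)"
        using ge[of "(i, j)"] zero[of i j] AM(4)[of i j] i by (cases "(i, j) \<in> ?P") (auto intro: mult_left_mono)
    qed (use x' i in \<open>auto intro: less_imp_le\<close>)
    then show "?\<mu> * x $ i \<le> (A ^\<^sub>m ?p *\<^sub>v x) $ i" using R'(3)[OF i] by simp
  qed
  \<comment> \<open>For an eigenvector \<open>x\<close>, \<open>R (k + m)\<close> is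
    \<open>rho A ^ m\<close> times \<open>x\<close>, so every quotient is exactly
    \<open>rho A ^ (M + N)\<close> and minimum and maximum coincide.\<close>
  have const: "row_ratio A M N k ` ?P = {rho A}" if ev: "A *\<^sub>v x = rho A \<cdot>\<^sub>v x"
  proof -
    have "x \<noteq> 0\<^sub>v n" using x'(3)[OF n] n by auto
    then have "eigenvector A x (rho A)" using ev x'(1) A'(2) by (simp add: eigenvector_def)
    then have Rk: "R (k + m) $ i = rho A ^ m * x $ i" if "i < n" for m i
      using eigenvector_pow[OF A'(1), of x "rho A" m] Radd[of m k] that x'
      by (simp add: x_def add.commute)
    have "row_ratio A M N k ij = rho A" if "ij \<in> ?P" for ij
    proof -
      have "g ij = ?\<mu>" using that x'(3) unfolding P g_def by (force simp: Rk power_add)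
      then show ?thesis
        unfolding ratio[OF that] using le_powr_inverse_iff[OF rho0 gpos[OF that] p]
        by (metis order.refl order_antisym)
    qed
    then show ?thesis using neP by auto
  qed
  \<comment> \<open>A minimum equal to \<open>rho A\<close> bounds all quotients from below, making
    \<open>x\<close> superinvariant; the maximum below gives the subinvariant case.\<close>
  have "A *\<^sub>v x = rho A \<cdot>\<^sub>v x" if "Min (row_ratio A M N k ` ?P) = rho A"
  proof (rule lower)
    fix ij assume ij: "ij \<in> ?P"
    then have "rho A \<le> row_ratio A M N k ij" unfolding that[symmetric] using finP by simp
    then show "?\<mu> \<le> g ij"
      unfolding ratio[OF ij] using le_powr_inverse_iff(1)[OF rho0 gpos[OF ij] p] by simp
  qed
  moreover have "A *\<^sub>v x = rho A \<cdot>\<^sub>v x" if "rho A = Max (row_ratio A M N k ` ?P)"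
  proof (rule upper)
    fix ij assume ij: "ij \<in> ?P"
    then have "row_ratio A M N k ij \<le> rho A" unfolding that using finP by simp
    then show "g ij \<le> ?\<mu>"
      unfolding ratio[OF ij] using le_powr_inverse_iff(2)[OF rho0 gpos[OF ij] p] by simp
  qed
  moreover have "Min (row_ratio A M N k ` ?P) = rho A" "rho A = Max (row_ratio A M N k ` ?P)"
    if "A *\<^sub>v x = rho A \<cdot>\<^sub>v x"
    unfolding const[OF that] by simp_all
  ultimately show ?thesis unfolding ev_iff by blast
qed

end
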